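(* Let $A$ be a tournament matrix of order $n$. If $\sigma_3(A)\ge 1/32$, then $\sigma_4(A)\ge g(\sigma_3(A))$, and equality $\sigma_4(A)=g(\sigma_3(A))$ holds if and only if there exists a vector $z\in\mathbb{R}^n$ such that $A_{i,j}=1/2+z_i-z_j$ for all $i,j\in\{1,\ldots,n\}$.
   Context: A tournament matrix of order $n$ is a real $n\times n$ matrix $A$ with non-negative entries such that $A+A^T=\mathbb{J}$, where $\mathbb{J}$ is the $n\times n$ matrix with all entries equal to $1$ (in particular every diagonal entry of $A$ equals $1/2$). For a square matrix $A$ of order $n$ and an integer $\ell\ge 1$, $\sigma_\ell(A)=\frac{1}{n^\ell}\sum_{i=1}^n\lambda_i^\ell=\frac{1}{n^\ell}\operatorname{Tr}A^\ell$, where $\lambda_1,\ldots,\lambda_n\in\mathbb{C}$ are the eigenvalues of $A$ (with multiplicity). Every tournament matrix satisfies $0\le\sigma_3(A)\le 1/8$. The function $g:[0,1/8]\to[0,1]$ is defined by $g(0)=0$ and, for $z\in(0,1]$, $$g\left(\tfrac18\left(\lfloor z^{-1}\rfloor z^3+(1-\lfloor z^{-1}\rfloor z)^3\right)\right)=\tfrac1{16}\left(\lfloor z^{-1}\rfloor z^4+(1-\lfloor z^{-1}\rfloor z)^4\right);$$ this is well defined because $z\mapsto\frac18\left(\lfloor z^{-1}\rfloor z^3+(1-\lfloor z^{-1}\rfloor z)^3\right)$ is a bijection from $(0,1]$ onto $(0,1/8]$. *)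

theory Defs
  imports "Jordan_Normal_Form.Spectral_Radius"
begin

definition tournament_matrix :: "nat \<Rightarrow> real mat \<Rightarrow> bool" where
  "tournament_matrix n A \<longleftrightarrow>
     A \<in> carrier_mat n n \<and> (\<forall>i<n. \<forall>j<n. 0 \<le> A $$ (i, j)) \<and>
     A + transpose_mat A = mat n n (\<lambda>_. 1)"

text \<open>The complex eigenvalues of a real matrix, repeated according to algebraic multiplicity.\<close>

definition eigenvalues :: "real mat \<Rightarrow> complex multiset" where
  "eigenvalues A = proots (char_poly (map_mat complex_of_real A))"

definition mat_trace :: "'a :: comm_monoid_add mat \<Rightarrow> 'a" where
  "mat_trace A = (\<Sum>i<dim_row A. A $$ (i, i))"

text \<open>The power sum of the eigenvalues of a real square matrix is real, so \<^const>\<open>Re\<close> only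
  changes the type; see \<open>of_real_sigma\<close> and \<open>sigma_eq_mat_trace\<close> below.\<close>

definition sigma :: "nat \<Rightarrow> real mat \<Rightarrow> real" where
  "sigma l A = 1 / real (dim_row A) ^ l * Re (\<Sum>x\<in>#eigenvalues A. x ^ l)"

definition g_arg :: "real \<Rightarrow> real" where
  "g_arg z = 1/8 * (of_int \<lfloor>1/z\<rfloor> * z ^ 3 + (1 - of_int \<lfloor>1/z\<rfloor> * z) ^ 3)"

definition g_val :: "real \<Rightarrow> real" where
  "g_val z = 1/16 * (of_int \<lfloor>1/z\<rfloor> * z ^ 4 + (1 - of_int \<lfloor>1/z\<rfloor> * z) ^ 4)"

text \<open>Only the values on the interval from \<open>0\<close> to \<open>1/8\<close> are meaningful; they are
  characterised by \<open>g_0\<close> and \<open>g_g_arg\<close> below.\<close>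

definition g :: "real \<Rightarrow> real" where
  "g x = (if x = 0 then 0 else g_val (inv_into {0<..1} g_arg x))"


subsection \<open>Power sums of eigenvalues as traces\<close>

lemma mat_trace_comm:
  fixes A B :: "'a :: comm_ring_1 mat"
  assumes "A \<in> carrier_mat n m" "B \<in> carrier_mat m n"
  shows "mat_trace (A * B) = mat_trace (B * A)"
proof -
  have "mat_trace (A * B) = (\<Sum>i<n. \<Sum>j<m. A $$ (i, j) * B $$ (j, i))"
    using assms by (auto simp: mat_trace_def scalar_prod_def lessThan_atLeast0)
  also have "\<dots> = (\<Sum>j<m. \<Sum>i<n. B $$ (j, i) * A $$ (i, j))"
    by (subst sum.swap) (simp add: mult.commute)
  also have "\<dots> = mat_trace (B * A)"
    using assms by (auto simp: mat_trace_def scalar_prod_def lessThan_atLeast0)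
  finally show ?thesis .
qed

lemma upper_triangular_pow_mat:
  fixes B :: "'a :: comm_ring_1 mat"
  assumes B: "B \<in> carrier_mat n n" and ut: "upper_triangular B"
  shows "upper_triangular (B ^\<^sub>m k) \<and> (\<forall>i<n. (B ^\<^sub>m k) $$ (i, i) = (B $$ (i, i)) ^ k)"
proof (induction k)
  case 0
  then show ?case using B by auto
next
  case (Suc k)
  have P: "B ^\<^sub>m k \<in> carrier_mat n n" using B by simp
  have entry: "(B ^\<^sub>m Suc k) $$ (i, j) = (\<Sum>m\<in>{0..<n}. (B ^\<^sub>m k) $$ (i, m) * B $$ (m, j))"
    if "i < n" "j < n" for i j
    using that B P by (auto simp: scalar_prod_def)
  have low: "(B ^\<^sub>m k) $$ (i, j) = 0" "B $$ (i, j) = 0" if "j < i" "i < n" for i j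
    using that Suc ut B P by (auto dest!: upper_triangularD)
  have "(B ^\<^sub>m Suc k) $$ (i, j) = 0" if "j < i" "i < n" for i j
  proof -
    have "(B ^\<^sub>m k) $$ (i, m) * B $$ (m, j) = 0" if "m \<in> {0..<n}" for m
      using low[of m i] low[of j m] that \<open>j < i\<close> \<open>i < n\<close> by (cases "m < i") auto
    then show ?thesis using entry[of i j] that by simp
  qed
  moreover have "(B ^\<^sub>m Suc k) $$ (i, i) = (B $$ (i, i)) ^ Suc k" if i: "i < n" for i
  proof -
    have "(B ^\<^sub>m k) $$ (i, m) * B $$ (m, i) = (if m = i then (B $$ (i, i)) ^ Suc k else 0)"
      if "m \<in> {0..<n}" for m
    proof (cases m i rule: linorder_cases)
      case less
      then show ?thesis using low(1)[of m i] i by simp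
    next
      case equal
      then show ?thesis using Suc i by (simp add: mult.commute)
    next
      case greater
      then show ?thesis using low(2)[of i m] that by simp
    qed
    then show ?thesis using entry[OF i i] i by simp
  qed
  ultimately show ?case using P B by (auto intro!: upper_triangularI)
qed

lemma sum_eigenvalues_pow:
  assumes A: "A \<in> carrier_mat n n"
  shows "(\<Sum>x\<in>#eigenvalues A. x ^ l) = of_real (mat_trace (A ^\<^sub>m l))"
proof -
  let ?C = "map_mat complex_of_real A"
  have C: "?C \<in> carrier_mat n n" using A by simp
  obtain es where es: "char_poly ?C = (\<Prod>a\<leftarrow>es. [:- a, 1:])"
    using char_poly_factorized[OF C] by blast
  obtain B P Q where BPQ: "schur_decomposition ?C es = (B, P, Q)"
    by (cases "schur_decomposition ?C es") auto
  note sd = schur_decomposition[OF C es BPQ]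
  have sim: "similar_mat_wit ?C B P Q" and ut: "upper_triangular B" and diag: "diag_mat B = es"
    using sd by auto
  note D = similar_mat_witD2[OF C sim]
  have B: "B \<in> carrier_mat n n" and P: "P \<in> carrier_mat n n" and Q: "Q \<in> carrier_mat n n"
    and QP: "Q * P = 1\<^sub>m n"
    using D by auto
  have Bl: "B ^\<^sub>m l \<in> carrier_mat n n" using B by simp
  have "proots (\<Prod>a\<leftarrow>xs. [:- a, 1:]) = mset xs" for xs :: "complex list"
  proof (induction xs)
    case (Cons a xs)
    have "(\<Prod>a\<leftarrow>xs. [:- a, 1:]) \<noteq> (0 :: complex poly)"
      by (auto simp: prod_list_zero_iff)
    then have "proots ([:- a, 1:] * (\<Prod>a\<leftarrow>xs. [:- a, 1:]))
        = proots [:- a, 1:] + proots (\<Prod>a\<leftarrow>xs. [:- a, 1:])"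
      by (intro proots_mult) auto
    then show ?case using Cons by simp
  qed simp
  then have "(\<Sum>x\<in>#eigenvalues A. x ^ l) = (\<Sum>x\<leftarrow>es. x ^ l)"
    by (simp add: eigenvalues_def es sum_mset_sum_list flip: mset_map)
  also have "\<dots> = mat_trace (B ^\<^sub>m l)"
  proof -
    have "(\<Sum>x\<leftarrow>es. x ^ l) = (\<Sum>i<n. (B $$ (i, i)) ^ l)"
      using B unfolding diag[symmetric] diag_mat_def
      by (simp add: comp_def sum_list_sum_nth lessThan_atLeast0)
    then show ?thesis
      using upper_triangular_pow_mat[OF B ut, of l] B by (simp add: mat_trace_def)
  qed
  also have "\<dots> = mat_trace ((B ^\<^sub>m l * Q) * P)"
    using right_mult_one_mat[OF Bl] by (simp add: assoc_mult_mat[OF Bl Q P] QP)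
  also have "\<dots> = mat_trace (P * (B ^\<^sub>m l * Q))"
    using Bl P Q by (intro mat_trace_comm[of _ n n]) auto
  also have "P * (B ^\<^sub>m l * Q) = ?C ^\<^sub>m l"
    using similar_mat_wit_pow_id[OF sim, of l] Bl P Q
    by (simp add: assoc_mult_mat[of _ n n _ n _ n])
  also have "\<dots> = map_mat complex_of_real (A ^\<^sub>m l)"
    using A by (simp add: of_real_hom.mat_hom_pow)
  also have "mat_trace \<dots> = of_real (mat_trace (A ^\<^sub>m l))"
    using A by (simp add: mat_trace_def)
  finally show ?thesis .
qed

lemma sigma_eq_mat_trace:
  assumes "A \<in> carrier_mat n n"
  shows "sigma l A = 1 / real n ^ l * mat_trace (A ^\<^sub>m l)"
  using assms by (simp add: sigma_def sum_eigenvalues_pow)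

lemma of_real_sigma:
  assumes "A \<in> carrier_mat n n"
  shows "of_real (sigma l A) = 1 / of_nat n ^ l * (\<Sum>x\<in>#eigenvalues A. x ^ l)"
  using assms by (simp add: sigma_eq_mat_trace sum_eigenvalues_pow)


subsection \<open>Well-definedness of the function \<open>g\<close>\<close>

lemma floor_inverse_eq:
  fixes z :: real and k :: int
  assumes "z > 0" "k \<ge> 1"
  shows "\<lfloor>1/z\<rfloor> = k \<longleftrightarrow> 1 / (of_int k + 1) < z \<and> z \<le> 1 / of_int k"
  using assms by (auto simp: floor_eq_iff field_simps)

definition g_piece :: "int \<Rightarrow> real \<Rightarrow> real" where
  "g_piece k z = 1/8 * (of_int k * z ^ 3 + (1 - of_int k * z) ^ 3)"

lemma g_piece_ends:
  assumes "k \<ge> 1"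
  shows "g_piece k (1 / of_int k) = 1/8 * (1 / (of_int k)\<^sup>2)"
    and "g_piece k (1 / (of_int k + 1)) = 1/8 * (1 / (of_int k + 1)\<^sup>2)"
proof -
  have k: "real_of_int k > 0" "real_of_int k + 1 > 0" using assms by auto
  then show "g_piece k (1 / of_int k) = 1/8 * (1 / (of_int k)\<^sup>2)"
    by (simp add: g_piece_def power2_eq_square power3_eq_cube)
  have "1 - of_int k * (1 / (of_int k + 1)) = 1 / (of_int k + (1::real))"
    using k by (simp add: field_simps)
  then have "g_piece k (1 / (of_int k + 1)) = 1/8 * ((of_int k + 1) * (1 / (of_int k + 1)) ^ 3)"
    unfolding g_piece_def by (simp only: distrib_right mult_1)
  also have "\<dots> = 1/8 * (1 / (of_int k + 1)\<^sup>2)"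
    using k by (simp add: power2_eq_square power3_eq_cube)
  finally show "g_piece k (1 / (of_int k + 1)) = 1/8 * (1 / (of_int k + 1)\<^sup>2)" .
qed

lemma g_piece_strict_mono:
  assumes k: "k \<ge> 1" and x: "1 / (of_int k + 1) \<le> x" and xy: "x < y" and y: "y \<le> 1 / of_int k"
  shows "g_piece k x < g_piece k y"
proof (rule DERIV_pos_imp_increasing_open[OF xy])
  fix t assume t: "x < t" "t < y"
  have kp: "real_of_int k \<ge> 1" using k by simp
  have "1 / (of_int k + 1) < t" "t \<le> 1 / of_int k" using t x y by auto
  then have "1 - of_int k * t < t" "0 \<le> 1 - of_int k * t"
    using kp by (auto simp: field_simps)
  then have "(1 - of_int k * t)\<^sup>2 < t\<^sup>2" by (intro power_strict_mono) auto
  then have "0 < 3/8 * of_int k * (t\<^sup>2 - (1 - of_int k * t)\<^sup>2)" using kp by simp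
  moreover have "(g_piece k has_real_derivative
      3/8 * of_int k * (t\<^sup>2 - (1 - of_int k * t)\<^sup>2)) (at t)"
    unfolding g_piece_def by (auto intro!: derivative_eq_intros simp: algebra_simps)
  ultimately show "\<exists>d. (g_piece k has_real_derivative d) (at t) \<and> 0 < d" by blast
next
  show "continuous_on {x..y} (g_piece k)"
    unfolding g_piece_def by (intro continuous_intros)
qed

lemma g_arg_bounds:
  assumes z: "0 < z" "z \<le> 1"
  defines "k \<equiv> \<lfloor>1/z\<rfloor>"
  shows "k \<ge> 1" "1 / (of_int k + 1) < z" "z \<le> 1 / of_int k" "g_arg z = g_piece k z"
    "1/8 * (1 / (of_int k + 1)\<^sup>2) < g_arg z" "g_arg z \<le> 1/8 * (1 / (of_int k)\<^sup>2)"
proof -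
  show k: "k \<ge> 1" using z by (simp add: k_def le_floor_iff)
  show lo: "1 / (of_int k + 1) < z" and hi: "z \<le> 1 / of_int k"
    using floor_inverse_eq[OF z(1) k] by (auto simp: k_def)
  show eq: "g_arg z = g_piece k z" by (simp add: g_arg_def g_piece_def k_def)
  show "1/8 * (1 / (of_int k + 1)\<^sup>2) < g_arg z"
    using g_piece_strict_mono[OF k order_refl lo hi] unfolding eq g_piece_ends(2)[OF k] .
  show "g_arg z \<le> 1/8 * (1 / (of_int k)\<^sup>2)"
    using g_piece_strict_mono[OF k less_imp_le[OF lo] _ order_refl] hi
    unfolding eq g_piece_ends(1)[OF k, symmetric] by (cases "z = 1 / of_int k") auto
qed

lemma g_arg_strict_mono:
  assumes "0 < x" "x < y" "y \<le> 1"
  shows "g_arg x < g_arg y"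
proof -
  define j k where "j = \<lfloor>1/x\<rfloor>" and "k = \<lfloor>1/y\<rfloor>"
  have x: "0 < x" "x \<le> 1" and y: "0 < y" "y \<le> 1" using assms by auto
  note bx = g_arg_bounds[OF x, folded j_def]
  note by' = g_arg_bounds[OF y, folded k_def]
  have "k \<le> j" unfolding j_def k_def using assms by (intro floor_mono) (simp add: field_simps)
  show ?thesis
  proof (cases "k = j")
    case True
    then show ?thesis
      using g_piece_strict_mono[OF bx(1) less_imp_le[OF bx(2)] assms(2)] bx(4) by' by simp
  next
    case False
    then have "k + 1 \<le> j" using \<open>k \<le> j\<close> by simp
    then have kj: "real_of_int k + 1 \<le> real_of_int j" by linarith
    have "real_of_int k + 1 > 0" using by'(1) by simp
    then have "1 / (real_of_int j)\<^sup>2 \<le> 1 / (real_of_int k + 1)\<^sup>2"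
      using kj by (intro divide_left_mono power_mono mult_pos_pos zero_less_power) auto
    then show ?thesis using bx(6) by'(5) by linarith
  qed
qed

lemma bij_betw_g_arg: "bij_betw g_arg {0<..1} {0<..1/8}"
proof (rule bij_betw_imageI)
  show "inj_on g_arg {0<..1}"
  proof (rule inj_onI)
    fix x y assume "x \<in> {0<..1::real}" "y \<in> {0<..1}" "g_arg x = g_arg y"
    then show "x = y"
      using g_arg_strict_mono[of x y] g_arg_strict_mono[of y x]
      by (cases x y rule: linorder_cases) auto
  qed
  show "g_arg ` {0<..1} = {0<..1/8}"
  proof (intro equalityI subsetI)
    fix w assume "w \<in> g_arg ` {0<..1}"
    then obtain z where z: "0 < z" "z \<le> 1" and w: "w = g_arg z" by auto
    note b = g_arg_bounds[OF z]
    have "(1::real) \<le> (of_int \<lfloor>1/z\<rfloor>)\<^sup>2"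
      using b(1) by (intro one_le_power) auto
    then have "1 / (real_of_int \<lfloor>1/z\<rfloor>)\<^sup>2 \<le> 1" by (subst divide_le_eq_1) linarith
    moreover have "0 \<le> 1/8 * (1 / (real_of_int \<lfloor>1/z\<rfloor> + 1)\<^sup>2)" by simp
    ultimately have "0 < g_arg z" "g_arg z \<le> 1/8" using b(5,6) by linarith+
    then show "w \<in> {0<..1/8}" by (simp add: w)
  next
    fix w :: real assume w: "w \<in> {0<..1/8}"
    define s where "s = 1 / sqrt (8 * w)"
    define k where "k = \<lfloor>s\<rfloor>"
    have s: "s \<ge> 1" using w by (simp add: s_def)
    have sw: "w = 1/8 * (1 / s\<^sup>2)" using w by (simp add: s_def power_divide)
    have k: "k \<ge> 1" using s by (simp add: k_def le_floor_iff)
    then have kp: "real_of_int k \<ge> 1" by simp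
    have ks: "of_int k \<le> s" "s < of_int k + 1" unfolding k_def by linarith+
    have "(real_of_int k)\<^sup>2 \<le> s\<^sup>2" using ks kp by (intro power_mono) auto
    then have hi: "w \<le> g_piece k (1 / of_int k)"
      unfolding g_piece_ends[OF k] sw using kp s
      by (intro mult_left_mono divide_left_mono mult_pos_pos zero_less_power) auto
    have "s\<^sup>2 < (real_of_int k + 1)\<^sup>2" using ks s by (intro power_strict_mono) auto
    then have lo: "g_piece k (1 / (of_int k + 1)) < w"
      unfolding g_piece_ends[OF k] sw using kp s
      by (intro mult_strict_left_mono divide_strict_left_mono mult_pos_pos zero_less_power) auto
    have "\<exists>z\<ge>1 / (of_int k + 1). z \<le> 1 / of_int k \<and> g_piece k z = w"
    proof (rule IVT')
      show "1 / (of_int k + 1) \<le> 1 / real_of_int k" using kp by (simp add: field_simps)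
      show "continuous_on {1 / (of_int k + 1)..1 / real_of_int k} (g_piece k)"
        unfolding g_piece_def by (intro continuous_intros)
    qed (use lo hi in auto)
    then obtain z where z: "1 / (of_int k + 1) \<le> z" "z \<le> 1 / of_int k" "g_piece k z = w"
      by blast
    have zl: "1 / (of_int k + 1) < z" using z lo by (cases "z = 1 / (of_int k + 1)") auto
    have "0 < 1 / (real_of_int k + 1)" using kp by simp
    then have z0: "0 < z" using zl by linarith
    have "1 / real_of_int k \<le> 1" using kp by simp
    then have z1: "z \<le> 1" using z(2) by linarith
    have "\<lfloor>1/z\<rfloor> = k" using floor_inverse_eq[OF z0 k] zl z(2) by blast
    then have "g_arg z = w" using z(3) by (simp add: g_arg_def g_piece_def)
    then show "w \<in> g_arg ` {0<..1}" using z0 z1 by force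
  qed
qed

lemma g_0: "g 0 = 0"
  by (simp add: g_def)

lemma g_g_arg:
  assumes "z \<in> {0<..1}"
  shows "g (g_arg z) = g_val z"
proof -
  have "g_arg z \<in> {0<..1/8}" using bij_betw_g_arg assms by (auto simp: bij_betw_def)
  then show ?thesis
    using bij_betw_g_arg assms by (auto simp: g_def bij_betw_def inv_into_f_f)
qed

end

theory Submission
  imports Defs
begin

text \<open>
  Write \<open>A = J/2 + B\<close> with \<open>B\<close> skew-symmetric, and let \<open>v = B 1\<close> be the vector of row sums.
  Expanding traces gives \<open>tr A\<^sup>3 = n\<^sup>3/8 - 3/2 |v|\<^sup>2\<close> and
  \<open>tr A\<^sup>4 = n\<^sup>4/16 - n |v|\<^sup>2 + tr B\<^sup>4\<close>. For \<open>z \<ge> 1/2\<close> the floor in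
  \<open>g\<close> may be replaced by \<open>1\<close> (also at the endpoint, where it is \<open>2\<close>), so on the relevant range \<open>g\<close> is
  the polynomial \<open>(1 - 4 p + 2 p\<^sup>2) / 16\<close> in \<open>p = (1 - 8 \<sigma>\<^sub>3) / 3 = 4 |v|\<^sup>2 / n\<^sup>3\<close>, and the claim becomes
  \<open>tr B\<^sup>4 \<ge> 2 |v|\<^sup>4 / n\<^sup>2\<close>. Comparing \<open>B\<^sup>2\<close> with \<open>C\<^sup>2\<close> for \<open>C\<^sub>i\<^sub>j = (v\<^sub>i - v\<^sub>j) / n\<close> gives
  \<open>tr B\<^sup>4 = \<parallel>B\<^sup>2 - C\<^sup>2\<parallel>\<^sup>2 + 2 |B v|\<^sup>2 / n\<close>, and \<open>n |B v|\<^sup>2 \<ge> |v|\<^sup>4\<close> by Cauchy-Schwarz with the vector \<open>1\<close>.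
  Equality forces \<open>B\<^sup>2 = C\<^sup>2\<close>, whose trace alone already gives \<open>B = C\<close>.
\<close>

subsection \<open>Skew-symmetric arrays\<close>

text \<open>Skewness is demanded for all indices, so that exchanging indices needs no range
  conditions; only entries below \<open>n\<close> enter the sums.\<close>

locale skew_array =
  fixes n :: nat and b :: "nat \<Rightarrow> nat \<Rightarrow> real"
  assumes skew: "b j i = - b i j"
begin

definition row_sum :: "nat \<Rightarrow> real" where
  "row_sum i = (\<Sum>k<n. b i k)"

definition sq :: "nat \<Rightarrow> nat \<Rightarrow> real" where
  "sq i j = (\<Sum>k<n. b i k * b k j)"

definition row_norm2 :: real where
  "row_norm2 = (\<Sum>i<n. (row_sum i)\<^sup>2)"

definition image_row_sum :: "nat \<Rightarrow> real" where
  "image_row_sum i = (\<Sum>k<n. b i k * row_sum k)"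

section \<open>Index sums of the array and its square\<close>

lemma col_sum: "(\<Sum>k<n. b k j) = - row_sum j"
  unfolding row_sum_def sum_negf[symmetric] by (intro sum.cong refl) (rule skew)

lemma sq_sym: "sq j i = sq i j"
  unfolding sq_def
proof (intro sum.cong refl)
  fix k show "b j k * b k i = b i k * b k j"
    using skew[of j k] skew[of k i] by simp
qed

lemma sum_row_sum: "(\<Sum>i<n. row_sum i) = 0"
proof -
  have "(\<Sum>i<n. row_sum i) = (\<Sum>j<n. \<Sum>i<n. b i j)"
    unfolding row_sum_def by (rule sum.swap)
  then show ?thesis by (simp add: col_sum sum_negf)
qed

lemma sum_row_sum_left: "(\<Sum>i<n. \<Sum>j<n. row_sum i * b i j) = row_norm2"
  by (simp add: row_norm2_def power2_eq_square row_sum_def flip: sum_distrib_left)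

lemma sum_row_sum_right: "(\<Sum>i<n. \<Sum>j<n. row_sum j * b i j) = - row_norm2"
  by (subst sum.swap)
    (simp add: row_norm2_def power2_eq_square col_sum sum_negf flip: sum_distrib_left)

lemma sum_image_row_sum: "(\<Sum>i<n. image_row_sum i) = - row_norm2"
  using sum_row_sum_right by (simp add: image_row_sum_def mult.commute)

lemma sum_sq: "(\<Sum>i<n. \<Sum>j<n. sq i j) = - row_norm2"
proof -
  have "(\<Sum>i<n. \<Sum>j<n. sq i j) = (\<Sum>i<n. image_row_sum i)"
    unfolding sq_def image_row_sum_def row_sum_def
    by (rule sum.cong[OF refl], subst sum.swap) (simp add: sum_distrib_left)
  then show ?thesis by (simp add: sum_image_row_sum)
qed

text \<open>A symmetric array is orthogonal to a skew one: exchanging the indices changes the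
  sign.\<close>

lemma sum_sq_skew: "(\<Sum>i<n. \<Sum>j<n. sq i j * b i j) = 0"
proof -
  have "(\<Sum>i<n. \<Sum>j<n. sq i j * b i j) = (\<Sum>j<n. \<Sum>i<n. sq i j * b i j)"
    by (rule sum.swap)
  also have "\<dots> = (\<Sum>j<n. \<Sum>i<n. - (sq j i * b j i))"
  proof (intro sum.cong refl)
    fix i j show "sq i j * b i j = - (sq j i * b j i)"
      using sq_sym[of i j] skew[of i j] by simp
  qed
  finally show ?thesis by (simp add: sum_negf)
qed

lemma sum_row_sum_diff2: "(\<Sum>i<n. \<Sum>j<n. (row_sum i - row_sum j)\<^sup>2) = 2 * n * row_norm2"
  by (simp add: power2_diff sum.distrib sum_subtractf row_norm2_def sum_row_sum mult.assoc
      flip: sum_distrib_left sum_distrib_right)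

text \<open>By skewness \<open>v\<close> applied from the left gives \<open>- B v\<close>, so the
  quadratic form of \<open>B\<^sup>2\<close> at \<open>v\<close> is
  \<open>- |B v|\<^sup>2\<close>.\<close>

lemma sum_sq_row_sum:
  "(\<Sum>i<n. \<Sum>j<n. sq i j * (row_sum i * row_sum j)) = - (\<Sum>k<n. (image_row_sum k)\<^sup>2)"
proof -
  have left: "(\<Sum>i<n. row_sum i * b i k) = - image_row_sum k" for k
    unfolding image_row_sum_def sum_negf[symmetric]
  proof (intro sum.cong refl)
    fix i show "row_sum i * b i k = - (b k i * row_sum i)" using skew[of k i] by simp
  qed
  have "(\<Sum>i<n. \<Sum>j<n. sq i j * (row_sum i * row_sum j))
      = (\<Sum>i<n. \<Sum>j<n. \<Sum>k<n. row_sum i * b i k * (b k j * row_sum j))"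
    unfolding sq_def sum_distrib_right by (intro sum.cong refl) (simp add: mult_ac)
  also have "\<dots> = (\<Sum>i<n. \<Sum>k<n. row_sum i * b i k * image_row_sum k)"
    unfolding image_row_sum_def by (rule sum.cong[OF refl], subst sum.swap) (simp add: sum_distrib_left)
  also have "\<dots> = (\<Sum>k<n. (\<Sum>i<n. row_sum i * b i k) * image_row_sum k)"
    by (subst sum.swap) (simp add: sum_distrib_right)
  finally show ?thesis by (simp add: left power2_eq_square sum_negf)
qed

text \<open>The array \<open>(row_sum i - row_sum j) / n\<close> squares to \<open>model_sq\<close>.\<close>

definition model_sq :: "nat \<Rightarrow> nat \<Rightarrow> real" where
  "model_sq i j = - (row_sum i * row_sum j / n + row_norm2 / n\<^sup>2)"

lemma sum_model_sq_power2:
  "(\<Sum>i<n. \<Sum>j<n. (model_sq i j)\<^sup>2) = 2 * row_norm2\<^sup>2 / n\<^sup>2"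
proof -
  have prod: "(\<Sum>i<n. \<Sum>j<n. f i * f j) = (\<Sum>i<n. f i)\<^sup>2" for f :: "nat \<Rightarrow> real"
    by (simp add: power2_eq_square sum_product)
  have "(model_sq i j)\<^sup>2 = 1 / n\<^sup>2 * ((row_sum i)\<^sup>2 * (row_sum j)\<^sup>2)
      + 2 * row_norm2 / n ^ 3 * (row_sum i * row_sum j) + row_norm2\<^sup>2 / n ^ 4" for i j
    unfolding model_sq_def
    by (simp add: divide_inverse power_inverse power2_eq_square power3_eq_cube power4_eq_xxxx
        algebra_simps)
  then have "(\<Sum>i<n. \<Sum>j<n. (model_sq i j)\<^sup>2)
      = 1 / n\<^sup>2 * (\<Sum>i<n. \<Sum>j<n. (row_sum i)\<^sup>2 * (row_sum j)\<^sup>2)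
        + 2 * row_norm2 / n ^ 3 * (\<Sum>i<n. \<Sum>j<n. row_sum i * row_sum j)
        + (\<Sum>i<n. \<Sum>j<n. row_norm2\<^sup>2 / n ^ 4)"
    by (simp only: sum.distrib sum_distrib_left)
  \<comment> \<open>The mixed term vanishes because the row sums add up to 0; the other two terms
    contribute equally.\<close>
  also have "\<dots> = 1 / n\<^sup>2 * row_norm2\<^sup>2 + n * (n * (row_norm2\<^sup>2 / n ^ 4))"
    unfolding prod[of "\<lambda>i. (row_sum i)\<^sup>2"] prod[of row_sum] sum_row_sum
    by (simp add: row_norm2_def)
  finally show ?thesis
    by (cases "n = 0") (auto simp: field_simps power2_eq_square power4_eq_xxxx)
qed

lemma sum_sq_model_sq:
  "(\<Sum>i<n. \<Sum>j<n. sq i j * model_sq i j)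
    = (\<Sum>k<n. (image_row_sum k)\<^sup>2) / n + row_norm2\<^sup>2 / n\<^sup>2"
proof -
  have "sq i j * model_sq i j
      = - 1 / n * (sq i j * (row_sum i * row_sum j)) + - row_norm2 / n\<^sup>2 * sq i j" for i j
    by (simp add: model_sq_def algebra_simps)
  then have "(\<Sum>i<n. \<Sum>j<n. sq i j * model_sq i j)
      = - 1 / n * (\<Sum>i<n. \<Sum>j<n. sq i j * (row_sum i * row_sum j))
        + - row_norm2 / n\<^sup>2 * (\<Sum>i<n. \<Sum>j<n. sq i j)"
    by (simp only: sum.distrib sum_distrib_left)
  then show ?thesis
    unfolding sum_sq_row_sum sum_sq by (simp add: power2_eq_square)
qed

section \<open>The lower bound for the norm of \<open>sq\<close> and its equality case\<close>

lemma sum_sq_power2: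
  "(\<Sum>i<n. \<Sum>j<n. (sq i j)\<^sup>2)
    = (\<Sum>i<n. \<Sum>j<n. (sq i j - model_sq i j)\<^sup>2) + 2 * (\<Sum>k<n. (image_row_sum k)\<^sup>2) / n"
proof -
  have "(\<Sum>i<n. \<Sum>j<n. (sq i j - model_sq i j)\<^sup>2)
      = (\<Sum>i<n. \<Sum>j<n. (sq i j)\<^sup>2) + (\<Sum>i<n. \<Sum>j<n. (model_sq i j)\<^sup>2)
        - 2 * (\<Sum>i<n. \<Sum>j<n. sq i j * model_sq i j)"
    by (simp add: power2_diff sum.distrib sum_subtractf mult.assoc sum_distrib_left)
  \<comment> \<open>The terms in \<open>row_norm2\<close> from the norm of \<open>model_sq\<close>
    and from twice the inner product cancel.\<close>
  then show ?thesis by (simp add: sum_model_sq_power2 sum_sq_model_sq)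
qed

lemma row_norm2_image_row_sum: "row_norm2\<^sup>2 / n\<^sup>2 \<le> (\<Sum>k<n. (image_row_sum k)\<^sup>2) / n"
proof (cases "n = 0")
  case False
  \<comment> \<open>The mean of \<open>image_row_sum\<close> is \<open>- row_norm2 / n\<close>, so
    this is \<open>n\<close> times its variance.\<close>
  have "0 \<le> (\<Sum>k<n. (image_row_sum k + row_norm2 / n)\<^sup>2)" by (intro sum_nonneg) simp
  also have "\<dots> = (\<Sum>k<n. (image_row_sum k)\<^sup>2) + 2 * (row_norm2 / n) * (\<Sum>k<n. image_row_sum k)
      + n * (row_norm2 / n)\<^sup>2"
    by (simp only: power2_sum sum.distrib sum_distrib_left) (simp add: mult_ac)
  also have "\<dots> = (\<Sum>k<n. (image_row_sum k)\<^sup>2) - row_norm2\<^sup>2 / n"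
    using False by (simp add: sum_image_row_sum power2_eq_square)
  finally have "row_norm2\<^sup>2 / n / n \<le> (\<Sum>k<n. (image_row_sum k)\<^sup>2) / n"
    by (intro divide_right_mono) auto
  then show ?thesis by (simp add: power2_eq_square)
qed simp

lemma sum_sq_power2_ge: "2 * row_norm2\<^sup>2 / n\<^sup>2 \<le> (\<Sum>i<n. \<Sum>j<n. (sq i j)\<^sup>2)"
proof -
  have "0 \<le> (\<Sum>i<n. \<Sum>j<n. (sq i j - model_sq i j)\<^sup>2)" by (intro sum_nonneg) simp
  then show ?thesis using row_norm2_image_row_sum sum_sq_power2 by linarith
qed

lemma eq_row_sum_diff_if:
  assumes eq: "(\<Sum>i<n. \<Sum>j<n. (sq i j)\<^sup>2) = 2 * row_norm2\<^sup>2 / n\<^sup>2" and i: "i < n" and j: "j < n"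
  shows "b i j = row_sum i / n - row_sum j / n"
proof -
  have n: "n > 0" using i by simp
  have "0 \<le> (\<Sum>i<n. \<Sum>j<n. (sq i j - model_sq i j)\<^sup>2)" by (intro sum_nonneg) simp
  \<comment> \<open>The lower bound loses only this square and the Cauchy-Schwarz gap, both
    non-negative, so equality makes each vanish.\<close>
  then have "(\<Sum>i<n. \<Sum>j<n. (sq i j - model_sq i j)\<^sup>2) = 0"
    using row_norm2_image_row_sum sum_sq_power2 eq by linarith
  then have "sq k l = model_sq k l" if "k < n" "l < n" for k l
    using that by (simp add: sum_nonneg_eq_0_iff sum_nonneg)
  \<comment> \<open>Only the diagonal is used: by skewness the trace of \<open>B\<^sup>2\<close> is
    minus the squared norm of \<open>B\<close>.\<close>
  then have "(\<Sum>k<n. sq k k) = (\<Sum>k<n. model_sq k k)" by simp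
  also have "\<dots> = - (row_norm2 / n) - n * (row_norm2 / n\<^sup>2)"
    by (simp add: model_sq_def sum_negf sum.distrib row_norm2_def power2_eq_square sum_subtractf
        flip: sum_divide_distrib)
  also have "\<dots> = - (2 * row_norm2 / n)" using n by (simp add: power2_eq_square)
  also have "(\<Sum>k<n. sq k k) = - (\<Sum>k<n. \<Sum>l<n. (b k l)\<^sup>2)"
    unfolding sq_def sum_negf[symmetric]
  proof (intro sum.cong refl)
    fix k l show "b k l * b l k = - (b k l)\<^sup>2" using skew[of l k] by (simp add: power2_eq_square)
  qed
  finally have norm: "(\<Sum>k<n. \<Sum>l<n. (b k l)\<^sup>2) = 2 * row_norm2 / n" by simp
  \<comment> \<open>Both the inner product of \<open>B\<close> with \<open>C\<close> and the squared
    norm of \<open>C\<close> are \<open>2 * row_norm2 / n\<close>, which is also the value just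
    found for \<open>B\<close>; hence \<open>B - C\<close> has norm 0.\<close>
  have "(b k l - (row_sum k / n - row_sum l / n))\<^sup>2 = (b k l)\<^sup>2
      - 2 / n * (row_sum k * b k l) + 2 / n * (row_sum l * b k l)
      + 1 / n\<^sup>2 * (row_sum k - row_sum l)\<^sup>2" for k l
    using n by (simp add: field_simps power2_eq_square)
  then have "(\<Sum>k<n. \<Sum>l<n. (b k l - (row_sum k / n - row_sum l / n))\<^sup>2)
      = (\<Sum>k<n. \<Sum>l<n. (b k l)\<^sup>2) - 2 / n * (\<Sum>k<n. \<Sum>l<n. row_sum k * b k l)
        + 2 / n * (\<Sum>k<n. \<Sum>l<n. row_sum l * b k l)
        + 1 / n\<^sup>2 * (\<Sum>k<n. \<Sum>l<n. (row_sum k - row_sum l)\<^sup>2)"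
    by (simp add: sum.distrib sum_subtractf sum_distrib_left
        del: times_divide_eq_left times_divide_eq_right)
  also have "\<dots> = 0"
    unfolding norm sum_row_sum_left sum_row_sum_right sum_row_sum_diff2
    using n by (simp add: field_simps power2_eq_square)
  finally show ?thesis using i j by (simp add: sum_nonneg_eq_0_iff sum_nonneg)
qed

text \<open>The vector \<open>z\<close> differs from \<open>row_sum / n\<close> by a constant, which
  cancels in differences. So \<open>B = C\<close> and \<open>sq\<close> coincides with
  \<open>model_sq\<close>.\<close>

lemma sum_sq_power2_eq_if:
  assumes z: "\<And>i j. i < n \<Longrightarrow> j < n \<Longrightarrow> b i j = z i - z j"
  shows "(\<Sum>i<n. \<Sum>j<n. (sq i j)\<^sup>2) = 2 * row_norm2\<^sup>2 / n\<^sup>2"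
proof -
  have diff: "b i j = (row_sum i - row_sum j) / n" if "i < n" "j < n" for i j
  proof -
    have "row_sum k = n * z k - (\<Sum>l<n. z l)" if "k < n" for k
      using that by (simp add: row_sum_def z sum_subtractf)
    from this[OF that(1)] this[OF that(2)] have "row_sum i - row_sum j = n * (z i - z j)"
      by (simp add: algebra_simps)
    then show ?thesis using that by (simp add: z)
  qed
  have "sq i j = model_sq i j" if "i < n" "j < n" for i j
  proof -
    have "sq i j = (\<Sum>k<n. 1 / n\<^sup>2 * ((row_sum i + row_sum j) * row_sum k
        - row_sum i * row_sum j - (row_sum k)\<^sup>2))"
      unfolding sq_def
      by (intro sum.cong refl) (use that in \<open>simp add: diff field_simps power2_eq_square\<close>)
    also have "\<dots> = 1 / n\<^sup>2 * ((row_sum i + row_sum j) * (\<Sum>k<n. row_sum k)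
        - n * (row_sum i * row_sum j) - row_norm2)"
      by (simp add: sum_subtractf row_norm2_def
          del: times_divide_eq_left times_divide_eq_right flip: sum_distrib_left)
    also have "\<dots> = model_sq i j"
      using that by (simp add: model_sq_def sum_row_sum field_simps power2_eq_square)
    finally show ?thesis .
  qed
  then show ?thesis by (simp add: sum_model_sq_power2)
qed

end

subsection \<open>Traces of tournament matrices\<close>

lemma (in skew_array) sum_half_plus_prod:
  "(\<Sum>k<n. (1/2 + b i k) * (1/2 + b k j)) = n / 4 + (row_sum i - row_sum j) / 2 + sq i j"
proof -
  have "(1/2 + b i k) * (1/2 + b k j) = 1/4 + 1/2 * b i k + 1/2 * b k j + b i k * b k j" for k
    by (simp add: field_simps)
  then have "(\<Sum>k<n. (1/2 + b i k) * (1/2 + b k j))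
      = (\<Sum>k<n. 1/4) + 1/2 * (\<Sum>k<n. b i k) + 1/2 * (\<Sum>k<n. b k j) + sq i j"
    unfolding sq_def by (simp only: sum.distrib sum_distrib_left)
  then show ?thesis
    unfolding col_sum by (simp add: diff_divide_distrib flip: row_sum_def)
qed

lemma mat_trace_mult:
  assumes "P \<in> carrier_mat n n" "Q \<in> carrier_mat n n"
  shows "mat_trace (P * Q) = (\<Sum>i<n. \<Sum>j<n. P $$ (i, j) * Q $$ (j, i))"
  using assms by (auto simp: mat_trace_def scalar_prod_def lessThan_atLeast0)

context skew_array
begin

context
  fixes A :: "real mat"
  assumes A: "A \<in> carrier_mat n n"
    and entry: "\<And>i j. i < n \<Longrightarrow> j < n \<Longrightarrow> A $$ (i, j) = 1/2 + b i j"
begin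

lemma mult_self_entry:
  assumes "i < n" "j < n"
  shows "(A * A) $$ (i, j) = n / 4 + (row_sum i - row_sum j) / 2 + sq i j"
proof -
  have "(A * A) $$ (i, j) = (\<Sum>k<n. (1/2 + b i k) * (1/2 + b k j))"
    using A assms by (simp add: scalar_prod_def lessThan_atLeast0 entry)
  then show ?thesis by (simp add: sum_half_plus_prod)
qed

lemma mat_trace_pow3: "mat_trace (A ^\<^sub>m 3) = n ^ 3 / 8 - 3/2 * row_norm2"
proof -
  have "A ^\<^sub>m 3 = (A * A) * A" using A by (simp add: numeral_3_eq_3)
  then have "mat_trace (A ^\<^sub>m 3) = (\<Sum>i<n. \<Sum>j<n. (A * A) $$ (i, j) * A $$ (j, i))"
    using A mat_trace_mult[of "A * A" n A] by simp
  also have "\<dots> = (\<Sum>i<n. \<Sum>j<n. n / 8 + 1/4 * row_sum i - 1/4 * row_sum j + 1/2 * sq i j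
      - n / 4 * b i j - 1/2 * (row_sum i * b i j) + 1/2 * (row_sum j * b i j) - sq i j * b i j)"
  proof (intro sum.cong refl)
    fix i j assume "i \<in> {..<n}" "j \<in> {..<n}"
    then show "(A * A) $$ (i, j) * A $$ (j, i)
      = n / 8 + 1/4 * row_sum i - 1/4 * row_sum j + 1/2 * sq i j
      - n / 4 * b i j - 1/2 * (row_sum i * b i j) + 1/2 * (row_sum j * b i j) - sq i j * b i j"
      using skew[of j i] by (simp add: mult_self_entry entry field_simps del: index_mult_mat)
  qed
  \<comment> \<open>Besides the constant, three summands survive, each contributing
    \<open>- row_norm2 / 2\<close>.\<close>
  also have "\<dots> = n * (n * (n / 8)) + 1/2 * - row_norm2 - 1/2 * row_norm2 + 1/2 * - row_norm2"
    by (simp only: sum.distrib sum_subtractf sum_sq sum_sq_skew sum_row_sum_left sum_row_sum_right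
        flip: sum_distrib_left)
      (simp add: sum_row_sum row_norm2_def power2_eq_square col_sum
        flip: sum_distrib_left row_sum_def)
  finally show ?thesis by (simp add: power3_eq_cube)
qed

lemma mat_trace_pow4:
  "mat_trace (A ^\<^sub>m 4) = n ^ 4 / 16 - n * row_norm2 + (\<Sum>i<n. \<Sum>j<n. (sq i j)\<^sup>2)"
proof -
  have "A ^\<^sub>m 4 = (A * A) * (A * A)" using A by (simp add: numeral_eq_Suc assoc_mult_mat[of _ n n _ n _ n])
  then have "mat_trace (A ^\<^sub>m 4) = (\<Sum>i<n. \<Sum>j<n. (A * A) $$ (i, j) * (A * A) $$ (j, i))"
    using A mat_trace_mult[of "A * A" n "A * A"] by simp
  \<comment> \<open>The two factors are \<open>s + d\<close> and \<open>s - d\<close> with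
    \<open>s = n / 4 + sq i j\<close> symmetric and \<open>d = (row_sum i - row_sum j) / 2\<close>
    skew, so the product is \<open>s\<^sup>2 - d\<^sup>2\<close>.\<close>
  also have "\<dots> = (\<Sum>i<n. \<Sum>j<n. (real n)\<^sup>2 / 16 + n / 2 * sq i j + (sq i j)\<^sup>2
      - 1/4 * (row_sum i - row_sum j)\<^sup>2)"
  proof (intro sum.cong refl)
    fix i j assume "i \<in> {..<n}" "j \<in> {..<n}"
    then show "(A * A) $$ (i, j) * (A * A) $$ (j, i)
      = (real n)\<^sup>2 / 16 + n / 2 * sq i j + (sq i j)\<^sup>2 - 1/4 * (row_sum i - row_sum j)\<^sup>2"
      using sq_sym[of j i]
      by (simp add: mult_self_entry power2_eq_square field_simps del: index_mult_mat)
  qed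
  also have "\<dots> = n * (n * ((real n)\<^sup>2 / 16)) + n / 2 * (\<Sum>i<n. \<Sum>j<n. sq i j)
      + (\<Sum>i<n. \<Sum>j<n. (sq i j)\<^sup>2) - 1/4 * (\<Sum>i<n. \<Sum>j<n. (row_sum i - row_sum j)\<^sup>2)"
    by (simp add: sum.distrib sum_subtractf sum_distrib_left
        del: times_divide_eq_left times_divide_eq_right)
  finally show ?thesis
    unfolding sum_sq sum_row_sum_diff2 by (simp add: power2_eq_square power4_eq_xxxx field_simps)
qed

end

end

subsection \<open>The function \<open>g\<close> on \<open>[1/32, 1/8]\<close>\<close>

text \<open>The power sums of \<open>z\<close> and \<open>1 - z\<close> are polynomials in their
  product \<open>p\<close>.\<close>

lemma g_eq_poly:
  assumes "1/32 \<le> x" "x \<le> 1/8"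
  defines "p \<equiv> (1 - 8 * x) / 3"
  shows "g x = (1 - 4 * p + 2 * p\<^sup>2) / 16"
proof -
  \<comment> \<open>\<open>z\<close> is the larger root of \<open>t\<^sup>2 - t + p\<close>; its
    discriminant \<open>1 - 4 * p\<close> is non-negative exactly when
    \<open>x \<ge> 1/32\<close>.\<close>
  define w where "w = sqrt (1 - 4 * p)"
  define z where "z = (1 + w) / 2"
  have w: "0 \<le> w" "w \<le> 1" "w\<^sup>2 = 1 - 4 * p"
    using assms by (auto simp: w_def)
  have p: "p = z * (1 - z)" using w(3) by (simp add: z_def power2_eq_square field_simps)
  have z: "1/2 \<le> z" "z \<le> 1" using w by (auto simp: z_def)
  have "g_arg z = (z ^ 3 + (1 - z) ^ 3) / 8 \<and> g_val z = (z ^ 4 + (1 - z) ^ 4) / 16"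
  proof (cases "z = 1/2")
    case True
    show ?thesis unfolding True by (simp add: g_arg_def g_val_def power_divide)
  next
    case False
    then have "\<lfloor>1/z\<rfloor> = 1" using floor_inverse_eq[of z 1] z by simp
    then show ?thesis by (simp add: g_arg_def g_val_def)
  qed
  moreover have "z ^ 3 + (1 - z) ^ 3 = 1 - 3 * p"
    unfolding p by (simp add: power3_eq_cube algebra_simps)
  moreover have "z ^ 4 + (1 - z) ^ 4 = 1 - 4 * p + 2 * p\<^sup>2"
    unfolding p by (simp add: power4_eq_xxxx power2_eq_square algebra_simps)
  moreover have "8 * x = 1 - 3 * p" by (simp add: p_def field_simps)
  ultimately have "g_arg z = x" "g_val z = (1 - 4 * p + 2 * p\<^sup>2) / 16" by auto
  then show ?thesis using g_g_arg[of z] z by simp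
qed

theorem theorem5:
  fixes n :: nat and A :: "real mat"
  assumes "tournament_matrix n A"
    and "sigma 3 A \<ge> 1/32"
  shows "sigma 4 A \<ge> g (sigma 3 A) \<and>
    (sigma 4 A = g (sigma 3 A) \<longleftrightarrow>
      (\<exists>z \<in> carrier_vec n. \<forall>i<n. \<forall>j<n. A $$ (i, j) = 1/2 + z $ i - z $ j))"
proof -
  \<comment> \<open>Taking the skew part of \<open>A\<close>, rather than \<open>A - 1/2\<close>,
    makes \<open>skew\<close> hold for indices outside the matrix too.\<close>
  define b where "b i j = (A $$ (i, j) - A $$ (j, i)) / 2" for i j
  interpret skew_array n b by unfold_locales (simp add: b_def field_simps)
  have A: "A \<in> carrier_mat n n" and AT: "A + transpose_mat A = mat n n (\<lambda>_. 1)"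
    using assms(1) by (auto simp: tournament_matrix_def)
  have entry: "A $$ (i, j) = 1/2 + b i j" if "i < n" "j < n" for i j
    using arg_cong[OF AT, of "\<lambda>M. M $$ (i, j)"] A that by (simp add: b_def field_simps)
  \<comment> \<open>For \<open>n = 0\<close> division by zero makes \<open>sigma 3 A\<close> equal
    to 0, below \<open>1/32\<close>.\<close>
  have "n \<noteq> 0"
    using assms(2) sigma_eq_mat_trace[OF A, of 3] by (intro notI) simp
  then have n: "real n > 0" by simp
  define F where "F = (\<Sum>i<n. \<Sum>j<n. (sq i j)\<^sup>2)"
  define p where "p = (1 - 8 * sigma 3 A) / 3"
  have s3: "sigma 3 A = 1/8 - 3/2 * (row_norm2 / n ^ 3)"
    using n by (simp add: sigma_eq_mat_trace[OF A] mat_trace_pow3[OF A entry] field_simps)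
  have s4: "sigma 4 A = 1/16 - row_norm2 / n ^ 3 + F / n ^ 4"
    using n by (simp add: sigma_eq_mat_trace[OF A] mat_trace_pow4[OF A entry] F_def field_simps
        power4_eq_xxxx power3_eq_cube)
  have p: "p = 4 * row_norm2 / n ^ 3" by (simp add: p_def s3)
  have "0 \<le> row_norm2" by (simp add: row_norm2_def sum_nonneg)
  then have "sigma 3 A \<le> 1/8" by (simp add: s3)
  then have "g (sigma 3 A) = (1 - 4 * p + 2 * p\<^sup>2) / 16"
    using g_eq_poly assms(2) by (simp add: p_def)
  \<comment> \<open>With \<open>q = row_norm2 / n ^ 3\<close> the value of \<open>g\<close> is
    \<open>1/16 - q + 2 * q\<^sup>2\<close>, so the terms up to first order cancel.\<close>
  then have diff: "sigma 4 A - g (sigma 3 A) = (F - 2 * row_norm2\<^sup>2 / n\<^sup>2) / n ^ 4"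
    using n by (simp add: s4 p field_simps power2_eq_square power3_eq_cube power4_eq_xxxx)
  have "0 \<le> (F - 2 * row_norm2\<^sup>2 / n\<^sup>2) / n ^ 4"
    using sum_sq_power2_ge by (simp add: F_def)
  then have le: "g (sigma 3 A) \<le> sigma 4 A" unfolding diff[symmetric] by simp
  have "sigma 4 A = g (sigma 3 A) \<longleftrightarrow> F = 2 * row_norm2\<^sup>2 / n\<^sup>2"
    using diff n by auto
  also have "\<dots> \<longleftrightarrow> (\<exists>z \<in> carrier_vec n. \<forall>i<n. \<forall>j<n. A $$ (i, j) = 1/2 + z $ i - z $ j)"
  proof
    assume "F = 2 * row_norm2\<^sup>2 / n\<^sup>2"
    then have "A $$ (i, j) = 1/2 + row_sum i / n - row_sum j / n" if "i < n" "j < n" for i j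
      using eq_row_sum_diff_if[of i j] entry[of i j] that by (simp add: F_def)
    then show "\<exists>z \<in> carrier_vec n. \<forall>i<n. \<forall>j<n. A $$ (i, j) = 1/2 + z $ i - z $ j"
      by (intro bexI[of _ "vec n (\<lambda>i. row_sum i / n)"]) auto
  next
    assume "\<exists>z \<in> carrier_vec n. \<forall>i<n. \<forall>j<n. A $$ (i, j) = 1/2 + z $ i - z $ j"
    then obtain z where "\<forall>i<n. \<forall>j<n. A $$ (i, j) = 1/2 + z $ i - z $ j" by blast
    then have "b i j = z $ i - z $ j" if "i < n" "j < n" for i j
      using entry[OF that] that by simp
    then show "F = 2 * row_norm2\<^sup>2 / n\<^sup>2"
      unfolding F_def by (rule sum_sq_power2_eq_if)
  qed
  finally show ?thesis using le by blast
qed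

end
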